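(* Let $(L,\leq,0,1)$ be a bounded lattice. (i) Let $\{a_0,a_1,\ldots,a_n\}$ be a finite chain in $L$ with $0=a_0<a_1<a_2<\cdots<a_n=1$, put $e=a_1$, let $T_e$ be a $t$-norm on $[0,a_1]$, and for $i\in\{2,3,\ldots,n\}$ let $S_i$ be a $t$-conorm on $[a_{i-1},a_i]$. Put $U_1^S=T_e$. Then for every $i\in\{2,3,\ldots,n\}$ the function $U_i^S:[0,a_i]^2\to[0,a_i]$ defined recursively by $$U_i^S(x,y)=\begin{cases} U_{i-1}^S(x,y) & \text{if }(x,y)\in[0,a_{i-1}]^2,\\ S_i(x,y) & \text{if }(x,y)\in\,]a_{i-1},a_i]^2,\\ x\vee y & \text{if }(x,y)\in[0,e]\times(I_{a_{i-1}}^{e}\cup\,]a_{i-1},a_i])\cup(I_{a_{i-1}}^{e}\cup\,]a_{i-1},a_i])\times[0,e],\\ x & \text{if }(x,y)\in I_{e,a_{i-1}}\times[0,e],\\ y & \text{if }(x,y)\in[0,e]\times I_{e,a_{i-1}},\\ S_i(x\vee a_{i-1},\,y\vee a_{i-1}) & \text{otherwise}\end{cases}$$ is a uninorm on $[0,a_i]$. (Here the sets $I_{a_{i-1}}^{e}$ and $I_{e,a_{i-1}}$ are taken inside $[0,a_i]$.) (ii) Let $\{b_0,b_1,\ldots,b_n\}$ be a finite chain in $L$ with $0=b_n\le b_{n-1}\le b_{n-2}\le\cdots\le b_0=1$, put $e=b_1$, let $S_e$ be a $t$-conorm on $[b_1,1]$, and for $i\in\{2,3,\ldots,n\}$ let $T_i$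 be a $t$-norm on $[b_i,b_{i-1}]$. Put $U_1^T=S_e$. Then for every $i\in\{2,3,\ldots,n\}$ the function $U_i^T:[b_i,1]^2\to[b_i,1]$ defined recursively by $$U_i^T(x,y)=\begin{cases} U_{i-1}^T(x,y) & \text{if }(x,y)\in[b_{i-1},1]^2,\\ T_i(x,y) & \text{if }(x,y)\in[b_i,b_{i-1}[^2,\\ x\wedge y & \text{if }(x,y)\in[e,1]\times(I_{b_{i-1}}^{e}\cup[b_i,b_{i-1}[)\cup(I_{b_{i-1}}^{e}\cup[b_i,b_{i-1}[)\times[e,1],\\ x & \text{if }(x,y)\in I_{e,b_{i-1}}\times[e,1],\\ y & \text{if }(x,y)\in[e,1]\times I_{e,b_{i-1}},\\ T_i(x\wedge b_{i-1},\,y\wedge b_{i-1}) & \text{otherwise}\end{cases}$$ is a uninorm on $[b_i,1]$. (Here the sets $I_{b_{i-1}}^{e}$ and $I_{e,b_{i-1}}$ are taken inside $[b_i,1]$.)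
   Context: A bounded lattice $(L,\leq,0,1)$ is a lattice with bottom element $0$ and top element $1$. For $a\le b$ in $L$: $[a,b]=\{x\in L: a\le x\le b\}$, $[a,b[\,=\{x: a\le x<b\}$, $]a,b]=\{x: a<x\le b\}$. Write $x\parallel y$ if $x$ and $y$ are incomparable. For elements $e$ and $a$: $I_{a}^{e}$ is the set of elements $x$ (of the interval under consideration) with $x\parallel a$ and $x$ comparable with $e$; $I_{e,a}$ is the set of elements $x$ (of the interval under consideration) with $x\parallel e$ and $x\parallel a$. A $t$-norm (resp. $t$-conorm) on a bounded lattice is a binary operation on it that is commutative, associative, increasing in both variables, and has the top (resp. bottom) element of that lattice as neutral element; each interval $[a,b]$ is regarded as a bounded lattice with bottom $a$ and top $b$. A uninorm on a bounded lattice $M$ is a map $U:M^2\to M$ that is commutative, associative, increasing in both variables, and has a neutral element $e\in M$, i.e. $U(e,x)=x$ for all $x\in M$. *)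

theory Defs
  imports Main
begin

definition incomparable :: "'a::order \<Rightarrow> 'a \<Rightarrow> bool" where
  "incomparable x y \<longleftrightarrow> \<not> x \<le> y \<and> \<not> y \<le> x"

text \<open>The sets \<open>I\<^sub>a\<^sup>e\<close> and \<open>I\<^sub>e\<^sub>,\<^sub>a\<close>, taken inside the interval \<open>M\<close>.\<close>

definition incomp_comp :: "'a::order set \<Rightarrow> 'a \<Rightarrow> 'a \<Rightarrow> 'a set" where
  "incomp_comp M a e = {x \<in> M. incomparable x a \<and> \<not> incomparable x e}"

definition incomp_both :: "'a::order set \<Rightarrow> 'a \<Rightarrow> 'a \<Rightarrow> 'a set" where
  "incomp_both M e a = {x \<in> M. incomparable x e \<and> incomparable x a}"

text \<open>An operation on an interval \<open>M\<close> is a total HOL function of which only the values on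
  \<open>M \<times> M\<close> matter; it has to map \<open>M \<times> M\<close> into \<open>M\<close>.\<close>

definition comm_assoc_incr_on :: "'a::order set \<Rightarrow> ('a \<Rightarrow> 'a \<Rightarrow> 'a) \<Rightarrow> bool" where
  "comm_assoc_incr_on M F \<longleftrightarrow>
     (\<forall>x\<in>M. \<forall>y\<in>M. F x y \<in> M) \<and>
     (\<forall>x\<in>M. \<forall>y\<in>M. F x y = F y x) \<and>
     (\<forall>x\<in>M. \<forall>y\<in>M. \<forall>z\<in>M. F (F x y) z = F x (F y z)) \<and>
     (\<forall>x\<in>M. \<forall>y\<in>M. \<forall>z\<in>M. x \<le> y \<longrightarrow> F x z \<le> F y z \<and> F z x \<le> F z y)"

definition t_norm_on :: "'a::order \<Rightarrow> 'a \<Rightarrow> ('a \<Rightarrow> 'a \<Rightarrow> 'a) \<Rightarrow> bool" where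
  "t_norm_on a b T \<longleftrightarrow> comm_assoc_incr_on {a..b} T \<and> (\<forall>x\<in>{a..b}. T b x = x)"

definition t_conorm_on :: "'a::order \<Rightarrow> 'a \<Rightarrow> ('a \<Rightarrow> 'a \<Rightarrow> 'a) \<Rightarrow> bool" where
  "t_conorm_on a b S \<longleftrightarrow> comm_assoc_incr_on {a..b} S \<and> (\<forall>x\<in>{a..b}. S a x = x)"

definition uninorm_on :: "'a::order \<Rightarrow> 'a \<Rightarrow> ('a \<Rightarrow> 'a \<Rightarrow> 'a) \<Rightarrow> bool" where
  "uninorm_on a b U \<longleftrightarrow>
     comm_assoc_incr_on {a..b} U \<and> (\<exists>e\<in>{a..b}. \<forall>x\<in>{a..b}. U e x = x)"

text \<open>One step of the first recursion: \<open>c\<close> and \<open>d\<close> stand for \<open>a\<^sub>i\<^sub>-\<^sub>1\<close> and \<open>a\<^sub>i\<close>,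
  \<open>V\<close> for \<open>U\<^sub>i\<^sub>-\<^sub>1\<close>, and \<open>S\<close> for \<open>S\<^sub>i\<close>.\<close>

definition conorm_step ::
  "'a::bounded_lattice \<Rightarrow> 'a \<Rightarrow> 'a \<Rightarrow> ('a \<Rightarrow> 'a \<Rightarrow> 'a) \<Rightarrow> ('a \<Rightarrow> 'a \<Rightarrow> 'a) \<Rightarrow> 'a \<Rightarrow> 'a \<Rightarrow> 'a" where
  "conorm_step e c d S V x y =
     (let I1 = incomp_comp {bot..d} c e; I2 = incomp_both {bot..d} e c in
      if (x, y) \<in> {bot..c} \<times> {bot..c} then V x y
      else if (x, y) \<in> {c<..d} \<times> {c<..d} then S x y
      else if (x, y) \<in> {bot..e} \<times> (I1 \<union> {c<..d}) \<union> (I1 \<union> {c<..d}) \<times> {bot..e} then sup x y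
      else if (x, y) \<in> I2 \<times> {bot..e} then x
      else if (x, y) \<in> {bot..e} \<times> I2 then y
      else S (sup x c) (sup y c))"

text \<open>The index 0 is not used; the recursion starts at index 1.\<close>

fun U_conorm ::
  "(nat \<Rightarrow> 'a::bounded_lattice) \<Rightarrow> ('a \<Rightarrow> 'a \<Rightarrow> 'a) \<Rightarrow> (nat \<Rightarrow> 'a \<Rightarrow> 'a \<Rightarrow> 'a) \<Rightarrow> nat \<Rightarrow> 'a \<Rightarrow> 'a \<Rightarrow> 'a" where
  "U_conorm a Te S 0 = Te"
| "U_conorm a Te S (Suc 0) = Te"
| "U_conorm a Te S (Suc (Suc k)) =
     conorm_step (a 1) (a (Suc k)) (a (Suc (Suc k))) (S (Suc (Suc k))) (U_conorm a Te S (Suc k))"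

text \<open>One step of the second recursion: \<open>c\<close> and \<open>d\<close> stand for \<open>b\<^sub>i\<^sub>-\<^sub>1\<close> and \<open>b\<^sub>i\<close>,
  \<open>V\<close> for \<open>U\<^sub>i\<^sub>-\<^sub>1\<close>, and \<open>T\<close> for \<open>T\<^sub>i\<close>.\<close>

definition norm_step ::
  "'a::bounded_lattice \<Rightarrow> 'a \<Rightarrow> 'a \<Rightarrow> ('a \<Rightarrow> 'a \<Rightarrow> 'a) \<Rightarrow> ('a \<Rightarrow> 'a \<Rightarrow> 'a) \<Rightarrow> 'a \<Rightarrow> 'a \<Rightarrow> 'a" where
  "norm_step e c d T V x y =
     (let I1 = incomp_comp {d..top} c e; I2 = incomp_both {d..top} e c in
      if (x, y) \<in> {c..top} \<times> {c..top} then V x y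
      else if (x, y) \<in> {d..<c} \<times> {d..<c} then T x y
      else if (x, y) \<in> {e..top} \<times> (I1 \<union> {d..<c}) \<union> (I1 \<union> {d..<c}) \<times> {e..top} then inf x y
      else if (x, y) \<in> I2 \<times> {e..top} then x
      else if (x, y) \<in> {e..top} \<times> I2 then y
      else T (inf x c) (inf y c))"

fun U_norm ::
  "(nat \<Rightarrow> 'a::bounded_lattice) \<Rightarrow> ('a \<Rightarrow> 'a \<Rightarrow> 'a) \<Rightarrow> (nat \<Rightarrow> 'a \<Rightarrow> 'a \<Rightarrow> 'a) \<Rightarrow> nat \<Rightarrow> 'a \<Rightarrow> 'a \<Rightarrow> 'a" where
  "U_norm b Se T 0 = Se"
| "U_norm b Se T (Suc 0) = Se"
| "U_norm b Se T (Suc (Suc k)) =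
     norm_step (b 1) (b (Suc k)) (b (Suc (Suc k))) (T (Suc (Suc k))) (U_norm b Se T (Suc k))"

end

theory Submission
  imports Defs
begin

text \<open>
  On \<open>[0, d]\<close> the six cases of the recursion step collapse to four: \<open>V\<close> on \<open>[0, c]\<^sup>2\<close>;
  otherwise the other argument if one argument lies below \<open>e\<close>; otherwise \<open>S (x \<squnion> c) (y \<squnion> c)\<close>.
  Associativity fails for an arbitrary uninorm \<open>V\<close>: for \<open>x \<le> e\<close>, \<open>y \<le> c\<close> with \<open>\<not> y \<le> e\<close>, and
  \<open>z \<parallel> c\<close> it forces \<open>\<not> V x y \<le> e\<close>. So the induction carries the additional invariant that
  \<open>V x y \<le> e\<close> implies \<open>x \<le> e\<close> and \<open>y \<le> e\<close>, which holds trivially for a t-norm on \<open>[0, e]\<close>.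
  Part (ii) is the order dual of part (i).
\<close>

section \<open>Ordered commutative monoids with respect to a given order relation\<close>

text \<open>The order is a parameter so that the same predicate can be used for
  \<open>(\<le>)\<close> and for \<open>(\<ge>)\<close>. Monotonicity is asked in one argument only;
  commutativity supplies the other.\<close>

definition ordered_comm_monoid_on ::
  "('a \<Rightarrow> 'a \<Rightarrow> bool) \<Rightarrow> 'a set \<Rightarrow> 'a \<Rightarrow> ('a \<Rightarrow> 'a \<Rightarrow> 'a) \<Rightarrow> bool" where
  "ordered_comm_monoid_on le M e F \<longleftrightarrow>
     (\<forall>x\<in>M. \<forall>y\<in>M. F x y \<in> M) \<and>
     (\<forall>x\<in>M. \<forall>y\<in>M. F x y = F y x) \<and>
     (\<forall>x\<in>M. \<forall>y\<in>M. \<forall>z\<in>M. F (F x y) z = F x (F y z)) \<and>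
     (\<forall>x\<in>M. \<forall>y\<in>M. \<forall>z\<in>M. le x y \<longrightarrow> le (F x z) (F y z)) \<and>
     (\<forall>x\<in>M. F e x = x)"

lemma ordered_comm_monoid_on_le_iff:
  "ordered_comm_monoid_on (\<le>) M e F \<longleftrightarrow> comm_assoc_incr_on M F \<and> (\<forall>x\<in>M. F e x = x)"
proof -
  have "(\<forall>x\<in>M. \<forall>y\<in>M. \<forall>z\<in>M. x \<le> y \<longrightarrow> F x z \<le> F y z) \<longleftrightarrow>
      (\<forall>x\<in>M. \<forall>y\<in>M. \<forall>z\<in>M. x \<le> y \<longrightarrow> F x z \<le> F y z \<and> F z x \<le> F z y)"
    if "\<forall>x\<in>M. \<forall>y\<in>M. F x y = F y x"
    using that by metis
  then show ?thesis
    unfolding ordered_comm_monoid_on_def comm_assoc_incr_on_def conj_assoc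
    by (intro conj_cong refl)
qed

text \<open>Reversing the order merely exchanges the two compared elements in the monotonicity
  condition, so the same operations qualify.\<close>

lemma ordered_comm_monoid_on_ge_iff:
  "ordered_comm_monoid_on (\<ge>) M e F \<longleftrightarrow> comm_assoc_incr_on M F \<and> (\<forall>x\<in>M. F e x = x)"
proof -
  have "(\<forall>x\<in>M. \<forall>y\<in>M. \<forall>z\<in>M. x \<ge> y \<longrightarrow> F x z \<ge> F y z) \<longleftrightarrow>
      (\<forall>x\<in>M. \<forall>y\<in>M. \<forall>z\<in>M. x \<le> y \<longrightarrow> F x z \<le> F y z \<and> F z x \<le> F z y)"
    if "\<forall>x\<in>M. \<forall>y\<in>M. F x y = F y x"
    using that by metis
  then show ?thesis
    unfolding ordered_comm_monoid_on_def comm_assoc_incr_on_def conj_assoc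
    by (intro conj_cong refl)
qed

lemma ordered_comm_monoid_onD:
  assumes "ordered_comm_monoid_on le M e F"
  shows "x \<in> M \<Longrightarrow> y \<in> M \<Longrightarrow> F x y \<in> M"
    and "x \<in> M \<Longrightarrow> y \<in> M \<Longrightarrow> F x y = F y x"
    and "x \<in> M \<Longrightarrow> y \<in> M \<Longrightarrow> z \<in> M \<Longrightarrow> F (F x y) z = F x (F y z)"
    and "x \<in> M \<Longrightarrow> y \<in> M \<Longrightarrow> z \<in> M \<Longrightarrow> le x y \<Longrightarrow> le (F x z) (F y z)"
    and "x \<in> M \<Longrightarrow> F e x = x"
proof -
  note * = assms[unfolded ordered_comm_monoid_on_def]
  show "x \<in> M \<Longrightarrow> y \<in> M \<Longrightarrow> F x y \<in> M"
    using *[THEN conjunct1] by blast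
  show "x \<in> M \<Longrightarrow> y \<in> M \<Longrightarrow> F x y = F y x"
    using *[THEN conjunct2, THEN conjunct1] by blast
  show "x \<in> M \<Longrightarrow> y \<in> M \<Longrightarrow> z \<in> M \<Longrightarrow> F (F x y) z = F x (F y z)"
    using *[THEN conjunct2, THEN conjunct2, THEN conjunct1] by blast
  show "x \<in> M \<Longrightarrow> y \<in> M \<Longrightarrow> z \<in> M \<Longrightarrow> le x y \<Longrightarrow> le (F x z) (F y z)"
    using *[THEN conjunct2, THEN conjunct2, THEN conjunct2, THEN conjunct1] by blast
  show "x \<in> M \<Longrightarrow> F e x = x"
    using *[THEN conjunct2, THEN conjunct2, THEN conjunct2, THEN conjunct2] by blast
qed

section \<open>The extension step in a join semilattice\<close>

context semilattice_sup
begin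

text \<open>The carrier is a down-set because a join semilattice need not have a bottom; in a
  bounded lattice it is \<open>[0, d]\<close>. The order is that of the locale, so the notion can
  also be read in the dual order.\<close>

definition reflecting_uninorm :: "'a \<Rightarrow> 'a \<Rightarrow> ('a \<Rightarrow> 'a \<Rightarrow> 'a) \<Rightarrow> bool" where
  "reflecting_uninorm e d U \<longleftrightarrow>
     ordered_comm_monoid_on (\<le>) {x. x \<le> d} e U \<and>
     (\<forall>x y. x \<le> d \<longrightarrow> y \<le> d \<longrightarrow> U x y \<le> e \<longrightarrow> x \<le> e \<and> y \<le> e)"

text \<open>The four-case form mentions only the order and joins, which makes the step available for
  both parts. Values outside the square of \<open>[0, c]\<close> never fall below \<open>c\<close>,
  so the clauses interact in few ways.\<close>

lemma reflecting_uninorm_extend: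
  assumes ec: "e \<le> c" and cd: "c \<le> d"
    and V: "reflecting_uninorm e c V"
    and S: "ordered_comm_monoid_on (\<le>) {x. c \<le> x \<and> x \<le> d} c S"
    and U: "\<And>x y. x \<le> d \<Longrightarrow> y \<le> d \<Longrightarrow>
      U x y = (if x \<le> c \<and> y \<le> c then V x y else if x \<le> e then y else if y \<le> e then x
               else S (sup x c) (sup y c))"
  shows "reflecting_uninorm e d U"
proof -
  have le: "x \<le> c" "x \<le> d" if "x \<le> e" for x
    using order_trans[OF that ec] order_trans[OF order_trans[OF that ec] cd] by simp_all
  have le': "x \<le> d" if "x \<le> c" for x
    using that cd by (rule order_trans)
  have leE: "\<not> x \<le> e" if "\<not> x \<le> c" for x
    using that le(1) by blast

  have Vm: "ordered_comm_monoid_on (\<le>) {x. x \<le> c} e V"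
    and Vr: "\<forall>x y. x \<le> c \<longrightarrow> y \<le> c \<longrightarrow> V x y \<le> e \<longrightarrow> x \<le> e \<and> y \<le> e"
    using V unfolding reflecting_uninorm_def by simp_all
  note Vd = ordered_comm_monoid_onD[OF Vm, unfolded mem_Collect_eq]
  have Vcl: "V x y \<le> c" and Vcom: "V x y = V y x" and Vid: "V e x = x"
    and Vrefl: "V x y \<le> e \<Longrightarrow> x \<le> e \<and> y \<le> e"
    if "x \<le> c" "y \<le> c" for x y
    using Vd(1)[OF that] Vd(2)[OF that] Vd(5)[OF that(1)] Vr that by simp_all
  have Vas: "V (V x y) z = V x (V y z)" and Vmo: "x \<le> y \<Longrightarrow> V x z \<le> V y z"
    if "x \<le> c" "y \<le> c" "z \<le> c" for x y z
    using Vd(3)[OF that] Vd(4)[OF that] by simp_all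
  \<comment> \<open>Monotonicity compares \<open>V x y\<close> with
    \<open>V e y = y\<close>.\<close>
  have Vle: "V x y \<le> y" if "x \<le> e" "y \<le> c" for x y
    using Vmo[OF le(1)[OF that(1)] ec that(2,1)] Vid[OF that(2,2)] by simp
  have Vle': "V y x \<le> y" if "x \<le> e" "y \<le> c" for x y
    using Vle[OF that] Vcom[OF le(1)[OF that(1)] that(2)] by simp
  have Vree: "V x y \<le> e" if "x \<le> e" "y \<le> e" for x y
    using order_trans[OF Vle[OF that(1) le(1)[OF that(2)]] that(2)] .

  \<comment> \<open>\<open>P\<close> is the last clause, regarded as an operation on all of
    \<open>[0, d]\<close>. Its values lie above \<open>c\<close>, so joining them with
    \<open>c\<close> again changes nothing and associativity carries over from
    \<open>S\<close>.\<close>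
  define P where "P x y = S (sup x c) (sup y c)" for x y
  have car: "c \<le> sup x c \<and> sup x c \<le> d" if "x \<le> d" for x
    using that cd by simp
  note Sd = ordered_comm_monoid_onD[OF S, unfolded mem_Collect_eq]
  have Scl: "c \<le> S x y \<and> S x y \<le> d" and Scom: "S x y = S y x" and Sid: "S c x = x"
    if "c \<le> x \<and> x \<le> d" "c \<le> y \<and> y \<le> d" for x y
    using Sd(1)[OF that] Sd(2)[OF that] Sd(5)[OF that(1)] by simp_all
  have Sas: "S (S x y) z = S x (S y z)" and Smo: "x \<le> y \<Longrightarrow> S x z \<le> S y z"
    if "c \<le> x \<and> x \<le> d" "c \<le> y \<and> y \<le> d" "c \<le> z \<and> z \<le> d" for x y z
    using Sd(3)[OF that] Sd(4)[OF that] by simp_all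
  have Pcl: "c \<le> P x y" "P x y \<le> d" and Pcom: "P x y = P y x" if "x \<le> d" "y \<le> d" for x y
    using Scl[OF that[THEN car]] Scom[OF that[THEN car]] unfolding P_def by simp_all
  have Psup: "sup (P x y) c = P x y" if "x \<le> d" "y \<le> d" for x y
    using Pcl[OF that] by (simp add: sup_absorb1)
  have Pas: "P (P x y) z = P x (P y z)" if "x \<le> d" "y \<le> d" "z \<le> d" for x y z
    using Sas[of "sup x c" "sup y c" "sup z c"] car that Psup[of x y] Psup[of y z]
    unfolding P_def by simp
  have Pmo: "P x z \<le> P y z" if "x \<le> y" "y \<le> d" "z \<le> d" for x y z
    using that unfolding P_def
    by (intro Smo car sup_mono order_refl order_trans[of x y d])
  \<comment> \<open>An argument below \<open>c\<close> is lifted to \<open>c\<close>, the neutral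
    element of \<open>S\<close>.\<close>
  have Pc: "P x y = sup y c" if "x \<le> c" "y \<le> d" for x y
    unfolding P_def using Sid[of "sup y c" "sup y c"] car[OF \<open>y \<le> d\<close>] that
    by (simp add: sup_absorb2)
  have Pge2: "y \<le> P x y" if "x \<le> d" "y \<le> d" for x y
  proof -
    have "y \<le> P c y"
      using Pc[of c y] that by simp
    also have "\<dots> \<le> P (sup x c) y"
      using Pmo[of c "sup x c" y] car that by simp
    also have "\<dots> = P x y"
      unfolding P_def by (simp add: sup_assoc)
    finally show ?thesis .
  qed
  have Pge1: "x \<le> P x y" if "x \<le> d" "y \<le> d" for x y
    using Pge2[of y x] Pcom that by simp
  have PN: "\<not> P x y \<le> c" "\<not> P x y \<le> e" if "x \<le> d" "y \<le> d" "\<not> (x \<le> c \<and> y \<le> c)" for x y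
  proof -
    show "\<not> P x y \<le> c"
      using order_trans[OF Pge1] order_trans[OF Pge2] that by blast
    then show "\<not> P x y \<le> e"
      by (rule leE)
  qed

  have UV: "U x y = V x y" if "x \<le> c" "y \<le> c" for x y
    using U[of x y] that le' by simp
  have UE: "U x y = y" "U y x = y" if "x \<le> e" "y \<le> d" "\<not> y \<le> c" for x y
    using U[of x y] U[of y x] that le leE
    by auto
  have UP: "U x y = P x y" if "x \<le> d" "y \<le> d" "\<not> x \<le> e" "\<not> y \<le> e" "\<not> (x \<le> c \<and> y \<le> c)" for x y
    using U[of x y] that unfolding P_def by auto

  have cl: "U x y \<le> d" if "x \<le> d" "y \<le> d" for x y
    using U[OF that] that Vcl[of x y] le'[of "V x y"] Pcl[of x y] unfolding P_def by simp
  have com: "U x y = U y x" if "x \<le> d" "y \<le> d" for x y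
    using U[OF that] U[OF that(2,1)] Vcom[of x y] Pcom[OF that] that le[of x] le[of y]
    unfolding P_def by auto
  have ident: "U e x = x" if "x \<le> d" for x
    using UV[of e x] UE[of e x] Vid[of x x] ec that by (cases "x \<le> c") auto
  \<comment> \<open>The invariant passes from \<open>V\<close> to \<open>U\<close>: with an argument
    outside \<open>[0, c]\<close>, the value is either that argument or a value of \<open>P\<close>
    above it, hence not below \<open>e\<close>.\<close>
  have refl: "x \<le> e \<and> y \<le> e" if "x \<le> d" "y \<le> d" "U x y \<le> e" for x y
    using U[OF that(1,2)] that Vrefl[of x y] PN[of x y] leE[of x] leE[of y]
    unfolding P_def by (auto split: if_splits)
  have UN: "\<not> U x y \<le> c" if "x \<le> d" "y \<le> d" "\<not> (x \<le> c \<and> y \<le> c)" for x y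
    using U[OF that(1,2)] that PN[of x y] le[of x] le[of y]
    unfolding P_def by auto
  have mono: "U x z \<le> U y z" if "x \<le> y" "y \<le> d" "z \<le> d" for x y z
  proof -
    have xd: "x \<le> d" using that(1,2) by (rule order_trans)
    have xc: "x \<le> c" if "y \<le> c" using \<open>x \<le> y\<close> that by (rule order_trans)
    have xe: "x \<le> e" if "y \<le> e" using \<open>x \<le> y\<close> that by (rule order_trans)
    \<comment> \<open>The letters V, E and P name the clauses that give \<open>U x z\<close> and
      \<open>U y z\<close>: \<open>V\<close>, an argument below \<open>e\<close>, or
      \<open>P\<close>. In NE and NP neither \<open>x\<close> nor \<open>y\<close> is below
      \<open>c\<close>, and both values come from the clause named by the second letter.\<close>
    consider (VV) "y \<le> c" "z \<le> c" | (VE) "x \<le> c" "\<not> y \<le> c" "z \<le> e"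
      | (VP) "x \<le> c" "\<not> y \<le> c" "z \<le> c" "\<not> z \<le> e" | (NE) "\<not> x \<le> c" "z \<le> e"
      | (NP) "\<not> x \<le> c" "\<not> z \<le> e" | (EE) "\<not> z \<le> c" "x \<le> e" "y \<le> e"
      | (EP) "\<not> z \<le> c" "x \<le> e" "\<not> y \<le> e" | (PP) "\<not> z \<le> c" "\<not> x \<le> e"
      using xc by blast
    then show ?thesis
    proof cases
      case VV
      then show ?thesis using UV[of x z] UV[of y z] Vmo[of x y z] xc that by simp
    next
      case VE
      have "V x z \<le> x" using Vle' VE by blast
      then have "V x z \<le> y" using \<open>x \<le> y\<close> by (rule order_trans)
      then show ?thesis using VE UV[of x z] UE[of z y] le[of z] \<open>y \<le> d\<close> by simp
    next
      case VP
      have "V x z \<le> c" using Vcl VP by blast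
      moreover have "c \<le> P y z" using Pcl that by blast
      ultimately have "V x z \<le> P y z" by (rule order_trans)
      then show ?thesis using VP that UV[of x z] UP[of y z] leE[of y] by simp
    next
      case NE
      then show ?thesis using UE[of z x] UE[of z y] xc xd that by auto
    next
      case NP
      have "\<not> y \<le> c" using xc NP by blast
      then show ?thesis
        using UP[of x z] UP[of y z] Pmo[of x y z] xd leE[of x] leE[of y] NP that by simp
    next
      case EE
      then show ?thesis using UE[of x z] UE[of y z] that by auto
    next
      case EP
      then show ?thesis using UE[of x z] UP[of y z] Pge2 leE that by auto
    next
      case PP
      then show ?thesis using UP[of x z] UP[of y z] Pmo xe xd leE that by auto
    qed
  qed
  \<comment> \<open>With \<open>z\<close> outside \<open>[0, c]\<close>, every product involving
    \<open>z\<close> avoids the clause for \<open>V\<close>, so only the positions of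
    \<open>x\<close> and \<open>y\<close> relative to \<open>e\<close> matter.\<close>
  have assN: "U (U x y) z = U x (U y z)" if "x \<le> d" "y \<le> d" "z \<le> d" "\<not> z \<le> c" for x y z
  proof -
    have ze: "\<not> z \<le> e" using that leE by blast
    have yz: "U y z \<le> d" "\<not> U y z \<le> c" "\<not> U y z \<le> e"
      using cl UN leE that by blast+
    consider (EE) "x \<le> e" "y \<le> e" | (EP) "x \<le> e" "\<not> y \<le> e" | (PE) "\<not> x \<le> e" "y \<le> e"
      | (PP) "\<not> x \<le> e" "\<not> y \<le> e" by blast
    then show ?thesis
    proof cases
      case EE
      then show ?thesis using UV[of x y] Vree[of x y] UE[of _ z] le that by auto
    next
      case EP
      \<comment> \<open>Here the invariant is decisive: if \<open>U x y\<close> fell below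
        \<open>e\<close>, the left side would be \<open>z\<close>, while the right side is
        \<open>P y z\<close>.\<close>
      have xy: "\<not> U x y \<le> e" "U x y \<le> d" using refl cl EP that by blast+
      have "P (U x y) z = P y z"
      proof (cases "y \<le> c")
        case True
        then show ?thesis using UV[of x y] Vcl[of x y] Pc[of _ z] le EP that by simp
      next
        case False
        then show ?thesis using UE[of x y] EP that by simp
      qed
      then show ?thesis
        using UP[of "U x y" z] UP[of y z] UE[of x "U y z"] xy yz ze EP that by simp
    next
      case PE
      have xy: "\<not> U x y \<le> e" "U x y \<le> d" using refl cl PE that by blast+
      have "P (U x y) z = P x z"
      proof (cases "x \<le> c")
        case True
        then show ?thesis using UV[of x y] Vcl[of x y] Pc[of _ z] le PE that by simp
      next
        case False
        then show ?thesis using UE[of y x] PE that by simp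
      qed
      then show ?thesis
        using UP[of "U x y" z] UP[of x z] UE[of y z] xy ze PE that by simp
    next
      case PP
      have xy: "\<not> U x y \<le> e" "U x y \<le> d" using refl cl PP that by blast+
      \<comment> \<open>If \<open>x\<close> and \<open>y\<close> are below \<open>c\<close>, then
        \<open>U x y\<close> is a value of \<open>V\<close> and may differ from
        \<open>P x y\<close>; yet both act on \<open>z\<close> as the join with
        \<open>c\<close>.\<close>
      have "P (U x y) z = P (P x y) z"
      proof (cases "x \<le> c \<and> y \<le> c")
        case True
        then have "P (P x y) z = P x (sup z c)"
          using Pas[of x y z] Pc[of y z] that by simp
        also have "\<dots> = sup z c"
          using Pc[of x "sup z c"] car[of z] True that by (simp add: sup_assoc)
        finally show ?thesis
          using UV[of x y] Vcl[of x y] Pc[of "U x y" z] True that by simp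
      next
        case False
        then show ?thesis using UP[of x y] PP that by simp
      qed
      then show ?thesis
        using UP[of "U x y" z] UP[of y z] UP[of x "U y z"] Pas[of x y z] xy yz ze PP that by simp
    qed
  qed
  \<comment> \<open>If some argument lies outside \<open>[0, c]\<close>, commutativity moves it to
    the last place, where \<open>assN\<close> applies; otherwise associativity of \<open>V\<close>
    is enough.\<close>
  have ass: "U (U x y) z = U x (U y z)" if "x \<le> d" "y \<le> d" "z \<le> d" for x y z
  proof (cases "z \<le> c")
    case False
    then show ?thesis using assN that by blast
  next
    case zc: True
    show ?thesis
    proof (cases "x \<le> c")
      case False
      then show ?thesis
        using assN[of z y x] com[of x y] com[of y z] com[of "U x y" z] com[of x "U y z"]
          com[of "U y x" z] com[of x "U z y"] cl[of x y] cl[of y z] that by simp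
    next
      case xc: True
      show ?thesis
      proof (cases "y \<le> c")
        case True
        then show ?thesis using UV[of x y] UV[of y z] UV[of "V x y" z] UV[of x "V y z"] Vas[of x y z]
          Vcl[of x y] Vcl[of y z] zc xc by simp
      next
        case False
        \<comment> \<open>The middle argument \<open>y\<close> is brought to the end twice, once for
          each side of the equation.\<close>
        have "U (U x y) z = U z (U x y)" using com[of "U x y" z] cl that by simp
        also have "\<dots> = U (U z x) y" using assN[of z x y] False that by simp
        also have "\<dots> = U (U x z) y" using com[of z x] that by simp
        also have "\<dots> = U x (U z y)" using assN[of x z y] False that by simp
        also have "\<dots> = U x (U y z)" using com[of z y] that by simp
        finally show ?thesis .
      qed
    qed
  qed
  show ?thesis
    unfolding reflecting_uninorm_def ordered_comm_monoid_on_def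
    by (intro conjI ballI allI impI; (elim CollectE)?) (assumption | rule cl com ass mono ident | simp add: refl)+
qed

end

section \<open>Passage to the order dual\<close>

text \<open>This turns the extension step into its dual, with \<open>inf\<close> for
  \<open>sup\<close>, so that the associativity argument is not repeated for part (ii).\<close>

lemma semilattice_sup_dual: "class.semilattice_sup inf (\<ge>) ((>) :: 'a::semilattice_inf \<Rightarrow> _)"
  by (rule class.semilattice_sup.intro, rule dual_order) (unfold_locales, simp_all)

lemmas dual_reflecting_uninorm_extend =
  semilattice_sup.reflecting_uninorm_extend[OF semilattice_sup_dual]

lemmas dual_reflecting_uninorm_def =
  semilattice_sup.reflecting_uninorm_def[OF semilattice_sup_dual]

section \<open>Reduction of the six cases to four, and preservation of the invariant\<close>

text \<open>A point of \<open>[0, d]\<close> outside \<open>[0, c]\<close> is in \<open>I1\<close>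
  or \<open>]c, d]\<close> exactly when it is above \<open>e\<close>, and in \<open>I2\<close>
  otherwise. Paired with an argument below \<open>e\<close>, it is returned in either case, as the
  join or directly. On \<open>]c, d]\<close> joining with \<open>c\<close> has no effect, so the
  clause for \<open>S\<close> merges with the last one.\<close>

lemma conorm_step_eq:
  fixes c d e :: "'a::bounded_lattice"
  assumes ec: "e \<le> c" and "x \<le> d" "y \<le> d"
  shows "conorm_step e c d S V x y =
    (if x \<le> c \<and> y \<le> c then V x y else if x \<le> e then y else if y \<le> e then x
     else S (sup x c) (sup y c))"
proof -
  have le: "z \<le> c" if "z \<le> e" for z
    using that ec by (rule order_trans)
  have mem1: "z \<in> incomp_comp {bot..d} c e \<union> {c<..d} \<longleftrightarrow> \<not> z \<le> c \<and> e \<le> z" if "z \<le> d" for z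
    using that le[of z] order_trans[OF ec, of z]
    unfolding incomp_comp_def incomparable_def by (auto simp: less_le_not_le)
  have mem2: "z \<in> incomp_both {bot..d} e c \<longleftrightarrow> \<not> z \<le> c \<and> \<not> e \<le> z" if "z \<le> d" for z
    using that le[of z] order_trans[OF ec, of z]
    unfolding incomp_both_def incomparable_def by auto
  have sup: "sup z w = w" "sup w z = w" if "z \<le> e" "e \<le> w" for z w
    using order_trans[OF that] by (simp_all add: sup_absorb1 sup_absorb2)
  have above: "sup z c = z" "\<not> z \<le> c" "\<not> z \<le> e" if "c < z" for z
    using that le[of z] by (auto simp: less_le_not_le sup_absorb1)
  show ?thesis
    unfolding conorm_step_def Let_def mem_Times_iff Un_iff[of _ "_ \<times> _"] fst_conv snd_conv
      mem1[OF \<open>x \<le> d\<close>] mem1[OF \<open>y \<le> d\<close>] mem2[OF \<open>x \<le> d\<close>] mem2[OF \<open>y \<le> d\<close>]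
    using assms le[of x] le[of y] sup[of x y] sup[of y x] above[of x] above[of y]
    by (cases "x \<le> e"; cases "y \<le> e"; cases "e \<le> x"; cases "e \<le> y"; auto)
qed

text \<open>\<open>norm_step\<close> is defined by its own formula rather than as an instance of
  \<open>conorm_step\<close>, so the dual case analysis is carried out separately.\<close>

lemma norm_step_eq:
  fixes c d e :: "'a::bounded_lattice"
  assumes ec: "c \<le> e" and "d \<le> x" "d \<le> y"
  shows "norm_step e c d T V x y =
    (if c \<le> x \<and> c \<le> y then V x y else if e \<le> x then y else if e \<le> y then x
     else T (inf x c) (inf y c))"
proof -
  have le: "c \<le> z" if "e \<le> z" for z
    using ec that by (rule order_trans)
  have mem1: "z \<in> incomp_comp {d..top} c e \<union> {d..<c} \<longleftrightarrow> \<not> c \<le> z \<and> z \<le> e" if "d \<le> z" for z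
    using that le[of z] order_trans[of z, OF _ ec]
    unfolding incomp_comp_def incomparable_def by (auto simp: less_le_not_le)
  have mem2: "z \<in> incomp_both {d..top} e c \<longleftrightarrow> \<not> c \<le> z \<and> \<not> z \<le> e" if "d \<le> z" for z
    using that le[of z] order_trans[of z, OF _ ec]
    unfolding incomp_both_def incomparable_def by auto
  have inf: "inf z w = w" "inf w z = w" if "e \<le> z" "w \<le> e" for z w
    using order_trans[OF that(2,1)] by (simp_all add: inf_absorb1 inf_absorb2)
  have below: "inf z c = z" "\<not> c \<le> z" "\<not> e \<le> z" if "z < c" for z
    using that le[of z] by (auto simp: less_le_not_le inf_absorb1)
  show ?thesis
    unfolding norm_step_def Let_def mem_Times_iff Un_iff[of _ "_ \<times> _"] fst_conv snd_conv
      mem1[OF \<open>d \<le> x\<close>] mem1[OF \<open>d \<le> y\<close>] mem2[OF \<open>d \<le> x\<close>] mem2[OF \<open>d \<le> y\<close>]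
    using assms le[of x] le[of y] inf[of x y] inf[of y x] below[of x] below[of y]
    by (cases "e \<le> x"; cases "e \<le> y"; cases "x \<le> e"; cases "y \<le> e"; auto)
qed

lemma reflecting_uninorm_conorm_step:
  fixes c d e :: "'a::bounded_lattice"
  assumes "e \<le> c" "c \<le> d" "reflecting_uninorm e c V" "t_conorm_on c d S"
  shows "reflecting_uninorm e d (conorm_step e c d S V)"
proof (rule reflecting_uninorm_extend[OF assms(1-3)])
  show "ordered_comm_monoid_on (\<le>) {x. c \<le> x \<and> x \<le> d} c S"
    using assms(4) unfolding t_conorm_on_def ordered_comm_monoid_on_le_iff atLeastAtMost_def
    by (simp add: atLeast_def atMost_def Collect_conj_eq)
qed (rule conorm_step_eq[OF assms(1)])

lemma dual_reflecting_uninorm_norm_step: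
  fixes c d e :: "'a::bounded_lattice"
  assumes "c \<le> e" "d \<le> c" "semilattice_sup.reflecting_uninorm (\<ge>) e c V" "t_norm_on d c T"
  shows "semilattice_sup.reflecting_uninorm (\<ge>) e d (norm_step e c d T V)"
proof (rule dual_reflecting_uninorm_extend[OF assms(1-3)])
  show "ordered_comm_monoid_on (\<ge>) {x. x \<le> c \<and> d \<le> x} c T"
    using assms(4) unfolding t_norm_on_def ordered_comm_monoid_on_ge_iff atLeastAtMost_def
    by (simp add: atLeast_def atMost_def Collect_conj_eq Int_commute)
qed (rule norm_step_eq[OF assms(1)])

lemma atLeastAtMost_bot: "{bot..d :: 'a::bounded_lattice} = {x. x \<le> d}"
  by auto

lemma atLeastAtMost_top: "{d :: 'a::bounded_lattice..top} = {x. d \<le> x}"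
  by auto

text \<open>The neutral element is \<open>e\<close>; the first assumption places it in the interval,
  which the invariant does not state.\<close>

lemma uninorm_on_if_reflecting:
  fixes d e :: "'a::bounded_lattice"
  assumes "e \<le> d" "reflecting_uninorm e d U"
  shows "uninorm_on bot d U"
  using assms unfolding uninorm_on_def reflecting_uninorm_def ordered_comm_monoid_on_le_iff
  by (auto simp: atLeastAtMost_bot)

lemma uninorm_on_if_dual_reflecting:
  fixes d e :: "'a::bounded_lattice"
  assumes "d \<le> e" "semilattice_sup.reflecting_uninorm (\<ge>) e d U"
  shows "uninorm_on d top U"
  using assms
  unfolding uninorm_on_def dual_reflecting_uninorm_def ordered_comm_monoid_on_ge_iff
  by (auto simp: atLeastAtMost_top)

section \<open>Induction along the chain\<close>

text \<open>At index 1 the carrier is \<open>[0, e]\<close> itself, so the invariant is immediate.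
  The inequality is carried along because the extension step requires
  \<open>e \<le> c\<close>.\<close>

lemma reflecting_uninorm_U_conorm:
  fixes a :: "nat \<Rightarrow> 'a::bounded_lattice"
  assumes "t_norm_on bot (a 1) Te"
    and "\<And>i. Suc 0 \<le> i \<Longrightarrow> i < n \<Longrightarrow> a i \<le> a (Suc i)"
    and "\<And>i. Suc 0 \<le> i \<Longrightarrow> i < n \<Longrightarrow> t_conorm_on (a i) (a (Suc i)) (S (Suc i))"
    and "Suc 0 \<le> i" "i \<le> n"
  shows "a 1 \<le> a i \<and> reflecting_uninorm (a 1) (a i) (U_conorm a Te S i)"
  using assms(4,5)
proof (induction i rule: dec_induct)
  case base
  show ?case
    using assms(1) unfolding t_norm_on_def reflecting_uninorm_def ordered_comm_monoid_on_le_iff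
    by (simp add: atLeastAtMost_bot)
next
  case (step i)
  then have IH: "a 1 \<le> a i" "reflecting_uninorm (a 1) (a i) (U_conorm a Te S i)"
    and le: "a i \<le> a (Suc i)" and S: "t_conorm_on (a i) (a (Suc i)) (S (Suc i))"
    using assms(2,3) by auto
  \<comment> \<open>The new index becomes \<open>Suc (Suc k)\<close>, the form of the recursive
    equation.\<close>
  obtain k where "i = Suc k"
    using step.hyps by (cases i) auto
  then show ?case
    using reflecting_uninorm_conorm_step[OF IH(1) le IH(2) S] order_trans[OF IH(1) le] by simp
qed

lemma dual_reflecting_uninorm_U_norm:
  fixes b :: "nat \<Rightarrow> 'a::bounded_lattice"
  assumes "t_conorm_on (b 1) top Se"
    and "\<And>i. Suc 0 \<le> i \<Longrightarrow> i < n \<Longrightarrow> b (Suc i) \<le> b i"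
    and "\<And>i. Suc 0 \<le> i \<Longrightarrow> i < n \<Longrightarrow> t_norm_on (b (Suc i)) (b i) (T (Suc i))"
    and "Suc 0 \<le> i" "i \<le> n"
  shows "b i \<le> b 1 \<and> semilattice_sup.reflecting_uninorm (\<ge>) (b 1) (b i) (U_norm b Se T i)"
  using assms(4,5)
proof (induction i rule: dec_induct)
  case base
  show ?case
    using assms(1)
    unfolding t_conorm_on_def dual_reflecting_uninorm_def ordered_comm_monoid_on_ge_iff
    by (simp add: atLeastAtMost_top)
next
  case (step i)
  then have IH: "b i \<le> b 1" "semilattice_sup.reflecting_uninorm (\<ge>) (b 1) (b i) (U_norm b Se T i)"
    and le: "b (Suc i) \<le> b i" and T: "t_norm_on (b (Suc i)) (b i) (T (Suc i))"
    using assms(2,3) by auto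
  obtain k where "i = Suc k"
    using step.hyps by (cases i) auto
  then show ?case
    using dual_reflecting_uninorm_norm_step[OF IH(1) le IH(2) T] order_trans[OF le IH(1)] by simp
qed

theorem theorem5p1:
  "(\<forall>(n::nat) (a :: nat \<Rightarrow> 'a::bounded_lattice) Te S.
      n \<ge> 1 \<and> a 0 = bot \<and> a n = top \<and> (\<forall>i<n. a i < a (Suc i)) \<and>
      t_norm_on bot (a 1) Te \<and>
      (\<forall>i\<in>{2..n}. t_conorm_on (a (i - 1)) (a i) (S i))
      \<longrightarrow> (\<forall>i\<in>{2..n}. uninorm_on bot (a i) (U_conorm a Te S i)))
   \<and>
   (\<forall>(n::nat) (b :: nat \<Rightarrow> 'a) Se T.
      n \<ge> 1 \<and> b n = bot \<and> b 0 = top \<and> (\<forall>i<n. b (Suc i) \<le> b i) \<and>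
      t_conorm_on (b 1) top Se \<and>
      (\<forall>i\<in>{2..n}. t_norm_on (b i) (b (i - 1)) (T i))
      \<longrightarrow> (\<forall>i\<in>{2..n}. uninorm_on (b i) top (U_norm b Se T i)))"
proof (intro conjI allI impI ballI)
  fix n :: nat and a :: "nat \<Rightarrow> 'a" and Te S i
  assume *: "n \<ge> 1 \<and> a 0 = bot \<and> a n = top \<and> (\<forall>i<n. a i < a (Suc i)) \<and>
      t_norm_on bot (a 1) Te \<and> (\<forall>i\<in>{2..n}. t_conorm_on (a (i - 1)) (a i) (S i))"
    and i: "i \<in> {2..n}"
  \<comment> \<open>Shifting the index by one removes the subtraction \<open>i - 1\<close> and
    matches the induction.\<close>
  have S: "t_conorm_on (a i) (a (Suc i)) (S (Suc i))" if "Suc 0 \<le> i" "i < n" for i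
    using *[THEN conjunct2, THEN conjunct2, THEN conjunct2, THEN conjunct2, THEN conjunct2,
      THEN bspec, of "Suc i"] that by simp
  have "a 1 \<le> a i \<and> reflecting_uninorm (a 1) (a i) (U_conorm a Te S i)"
    using * i by (intro reflecting_uninorm_U_conorm[where n = n] S) (auto intro: less_imp_le)
  then show "uninorm_on bot (a i) (U_conorm a Te S i)"
    using uninorm_on_if_reflecting by blast
next
  fix n :: nat and b :: "nat \<Rightarrow> 'a" and Se T i
  assume *: "n \<ge> 1 \<and> b n = bot \<and> b 0 = top \<and> (\<forall>i<n. b (Suc i) \<le> b i) \<and>
      t_conorm_on (b 1) top Se \<and> (\<forall>i\<in>{2..n}. t_norm_on (b i) (b (i - 1)) (T i))"
    and i: "i \<in> {2..n}"
  have T: "t_norm_on (b (Suc i)) (b i) (T (Suc i))" if "Suc 0 \<le> i" "i < n" for i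
    using *[THEN conjunct2, THEN conjunct2, THEN conjunct2, THEN conjunct2, THEN conjunct2,
      THEN bspec, of "Suc i"] that by simp
  have "b i \<le> b 1 \<and> semilattice_sup.reflecting_uninorm (\<ge>) (b 1) (b i) (U_norm b Se T i)"
    using * i by (intro dual_reflecting_uninorm_U_norm[where n = n] T) auto
  then show "uninorm_on (b i) top (U_norm b Se T i)"
    using uninorm_on_if_dual_reflecting by blast
qed

end
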